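(* (Weighted Dynkin–Specht–Wever lemma.) Let $K$ be a commutative ring with unit, and let weights $w_1,\ldots,w_n$ (each in $\mathbb Z$ or in $K$) be assigned to the variables $X_1,\ldots,X_n$. Suppose that $P^{\mathrm{Lie}}(X_1,\ldots,X_n)\in \mathrm F_K^{\mathrm{Lie}}[X_1,\ldots,X_n]$ expands in the commutator evaluation to the noncommutative polynomial \[P^{\mathrm{assoc}}(X_1,\ldots,X_n)=\sum_s a_s X_{i_{s,1}}\cdots X_{i_{s,p_s}}\qquad(a_s\in K,\ p_s\ge 1).\] Then, in $\mathrm F_K^{\mathrm{Lie}}[X_1,\ldots,X_n]$, \[w(P^{\mathrm{Lie}}(X_1,\ldots,X_n))=\sum_s a_s\,[X_{i_{s,1}},\ldots,X_{i_{s,p_s-1}},w(X_{i_{s,p_s}})]_{\mathrm L}.\]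
   Context: $\mathrm F_K^{\mathrm{Lie}}[X_1,\ldots,X_n]$ is the free Lie $K$-algebra on $X_1,\ldots,X_n$ (Lie bracket bilinear, with $[x,x]=0$ and the Jacobi identity); it is multigraded by the multiplicities of the variables. $\mathrm F_K[X_1,\ldots,X_n]$ is the free associative unital $K$-algebra. The commutator evaluation is the Lie algebra homomorphism $\mathrm F_K^{\mathrm{Lie}}[X_1,\ldots,X_n]\to \mathrm F_K[X_1,\ldots,X_n]$, $X_i\mapsto X_i$, where the target carries the bracket $ab-ba$. The linear map $w:\mathrm F_K^{\mathrm{Lie}}[X_1,\ldots,X_n]\to\mathrm F_K^{\mathrm{Lie}}[X_1,\ldots,X_n]$ is multiplication by $m_1w_1+\cdots+m_nw_n$ on the component of multidegree $X_1^{m_1}\cdots X_n^{m_n}$; in particular $w(X_i)=w_iX_i$. Left-iterated commutators: $[Y_1,\ldots,Y_p]_{\mathrm L}=[Y_1,[Y_2,\ldots,[Y_{p-1},Y_p]\ldots]]$, with $[Y_1]_{\mathrm L}=Y_1$. *)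

theory Defs
  imports Complex_Main "HOL-Library.Poly_Mapping"
begin

section \<open>Scalar multiplication of finitely supported functions\<close>

definition smult :: "'k::comm_ring_1 \<Rightarrow> ('a \<Rightarrow>\<^sub>0 'k) \<Rightarrow> ('a \<Rightarrow>\<^sub>0 'k)"
  where "smult c p = Poly_Mapping.map (\<lambda>x. c * x) p"

lemma lookup_smult [simp]: "Poly_Mapping.lookup (smult c p) t = c * Poly_Mapping.lookup p t"
  by (simp add: smult_def map.rep_eq when_def)

lemma smult_module: "module (smult :: 'k::comm_ring_1 \<Rightarrow> ('a \<Rightarrow>\<^sub>0 'k) \<Rightarrow> ('a \<Rightarrow>\<^sub>0 'k))"
  by unfold_locales (auto intro!: poly_mapping_eqI simp: lookup_add algebra_simps)

interpretation smult: module "smult :: 'k::comm_ring_1 \<Rightarrow> ('a \<Rightarrow>\<^sub>0 'k) \<Rightarrow> ('a \<Rightarrow>\<^sub>0 'k)"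
  by (rule smult_module)

lemma pm_linear_induct [case_names zero add single]:
  fixes p :: "'a \<Rightarrow>\<^sub>0 'k::comm_ring_1"
  assumes "P 0" and "\<And>p q. P p \<Longrightarrow> P q \<Longrightarrow> P (p + q)" and "\<And>t c. P (smult c (Poly_Mapping.single t 1))"
  shows "P p"
proof -
  have "P (\<Sum>t\<in>A. smult (Poly_Mapping.lookup p t) (Poly_Mapping.single t 1))" if "finite A" for A
    using that by (induction A) (auto intro: assms)
  moreover have "(\<Sum>t\<in>Poly_Mapping.keys p. smult (Poly_Mapping.lookup p t) (Poly_Mapping.single t 1)) = p"
    by (rule poly_mapping_eqI)
       (auto simp: lookup_sum lookup_single when_def if_distrib[of "\<lambda>x. _ * x"] in_keys_iff cong: if_cong)
  ultimately show ?thesis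
    by (metis finite_keys)
qed

section \<open>The free associative unital algebra\<close>

datatype 'n word = Word (letters: "'n list")

instantiation word :: (type) monoid_add
begin
definition zero_word :: "'a word" where "0 = Word []"
definition plus_word :: "'a word \<Rightarrow> 'a word \<Rightarrow> 'a word" where "u + v = Word (letters u @ letters v)"
instance by standard (auto simp: zero_word_def plus_word_def)
end

text \<open>
  The free monoid is written additively because the product of \<^theory>\<open>HOL-Library.Poly_Mapping\<close>
  is the convolution product over an additive monoid. So the ring structure on \<open>free_assoc\<close>
  is that of the monoid algebra of words.
\<close>

type_synonym ('n, 'k) free_assoc = "'n word \<Rightarrow>\<^sub>0 'k"

definition assoc_var :: "'n \<Rightarrow> ('n, 'k::comm_ring_1) free_assoc"
  where "assoc_var i = Poly_Mapping.single (Word [i]) 1"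

lemma smult_eq_times: "smult c p = Poly_Mapping.single 0 c * (p :: ('n, 'k::comm_ring_1) free_assoc)"
proof -
  have "prod_fun (\<lambda>k. c when k = (0 :: 'n word)) (Poly_Mapping.lookup p) v = c * Poly_Mapping.lookup p v" for v
    by (auto simp: prod_fun_def when_mult when_when)
  then show ?thesis
    by (intro poly_mapping_eqI) (simp add: times_poly_mapping.rep_eq single.rep_eq eq_commute)
qed

lemma smult_mult_left: "smult c p * q = smult c (p * q :: ('n, 'k::comm_ring_1) free_assoc)"
  by (simp add: smult_eq_times mult.assoc)

lemma smult_mult_right: "p * smult c q = smult c (p * q :: ('n, 'k::comm_ring_1) free_assoc)"
proof (induction p rule: pm_linear_induct)
  case (single t d)
  show ?case
  proof (induction q rule: pm_linear_induct)
    case (single s e)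
    have *: "smult a (Poly_Mapping.single r b) = Poly_Mapping.single r (a * b)"
      for a b :: 'k and r :: "'n word"
      by (rule poly_mapping_eqI) (auto simp: lookup_single when_def)
    show ?case by (simp add: * mult_single ac_simps)
  qed (simp_all add: algebra_simps smult.scale_right_distrib)
qed (simp_all add: algebra_simps smult.scale_right_distrib)

section \<open>The free Lie algebra\<close>

text \<open>
  The free Lie algebra is the free nonassociative algebra (the finitely supported functions on
  bracketings) modulo the two-sided ideal generated by all squares and all Jacobi expressions.
\<close>

datatype 'n magma = Gen 'n | Prod "'n magma" "'n magma"

type_synonym ('n, 'k) free_nonassoc = "'n magma \<Rightarrow>\<^sub>0 'k"

lift_definition nmult ::
  "('n, 'k::comm_ring_1) free_nonassoc \<Rightarrow> ('n, 'k) free_nonassoc \<Rightarrow> ('n, 'k) free_nonassoc"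
  is "\<lambda>f g t. case t of Gen i \<Rightarrow> 0 | Prod r s \<Rightarrow> f r * g s"
proof -
  fix f g :: "'n magma \<Rightarrow> 'k"
  assume "finite {t. f t \<noteq> 0}" "finite {t. g t \<noteq> 0}"
  moreover have "{t. (case t of Gen i \<Rightarrow> 0 | Prod r s \<Rightarrow> f r * g s) \<noteq> 0}
      \<subseteq> (\<lambda>(r, s). Prod r s) ` ({t. f t \<noteq> 0} \<times> {t. g t \<noteq> 0})"
  proof
    fix t
    assume "t \<in> {t. (case t of Gen i \<Rightarrow> 0 | Prod r s \<Rightarrow> f r * g s) \<noteq> 0}"
    then show "t \<in> (\<lambda>(r, s). Prod r s) ` ({t. f t \<noteq> 0} \<times> {t. g t \<noteq> 0})"
      by (cases t) auto
  qed
  ultimately show "finite {t. (case t of Gen i \<Rightarrow> 0 | Prod r s \<Rightarrow> f r * g s) \<noteq> 0}"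
    by (meson finite_SigmaI finite_imageI finite_subset)
qed

lemma lookup_nmult:
  "Poly_Mapping.lookup (nmult p q) t = (case t of Gen i \<Rightarrow> 0 | Prod r s \<Rightarrow> Poly_Mapping.lookup p r * Poly_Mapping.lookup q s)"
  by (simp add: nmult.rep_eq)

lemma nmult_linear:
  "nmult (p + p') q = nmult p q + nmult p' q" "nmult p (q + q') = nmult p q + nmult p q'"
  "nmult (p - p') q = nmult p q - nmult p' q" "nmult p (q - q') = nmult p q - nmult p q'"
  "nmult 0 q = 0" "nmult p 0 = 0"
  "nmult (smult c p) q = smult c (nmult p q)" "nmult p (smult c q) = smult c (nmult p q)"
  by (auto intro!: poly_mapping_eqI simp: lookup_nmult lookup_add lookup_minus algebra_simps split: magma.splits)

lemma nmult_single:
  "nmult (Poly_Mapping.single r 1) (Poly_Mapping.single s 1) = Poly_Mapping.single (Prod r s) 1"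
  by (auto intro!: poly_mapping_eqI simp: lookup_nmult lookup_single when_def split: magma.splits)

inductive_set lie_ideal :: "('n, 'k::comm_ring_1) free_nonassoc set" where
  zero: "0 \<in> lie_ideal"
| add: "p \<in> lie_ideal \<Longrightarrow> q \<in> lie_ideal \<Longrightarrow> p + q \<in> lie_ideal"
| smult: "p \<in> lie_ideal \<Longrightarrow> smult c p \<in> lie_ideal"
| mult_left: "p \<in> lie_ideal \<Longrightarrow> nmult q p \<in> lie_ideal"
| mult_right: "p \<in> lie_ideal \<Longrightarrow> nmult p q \<in> lie_ideal"
| square: "nmult p p \<in> lie_ideal"
| jacobi: "nmult p (nmult q r) + nmult q (nmult r p) + nmult r (nmult p q) \<in> lie_ideal"

lemma lie_ideal_uminus: "p \<in> lie_ideal \<Longrightarrow> - p \<in> lie_ideal"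
  using lie_ideal.smult[of p "-1"] by simp

lemma lie_ideal_diff: "p \<in> lie_ideal \<Longrightarrow> q \<in> lie_ideal \<Longrightarrow> p - q \<in> lie_ideal"
  using lie_ideal.add[of p "- q"] lie_ideal_uminus by auto

definition lie_eq :: "('n, 'k::comm_ring_1) free_nonassoc \<Rightarrow> ('n, 'k) free_nonassoc \<Rightarrow> bool"
  where "lie_eq p q \<longleftrightarrow> p - q \<in> lie_ideal"

quotient_type (overloaded) ('n, 'k) free_lie = "('n, 'k::comm_ring_1) free_nonassoc" / lie_eq
proof (rule equivpI)
  show "reflp (lie_eq :: ('n, 'k) free_nonassoc \<Rightarrow> _)"
    by (simp add: reflp_def lie_eq_def lie_ideal.zero)
  show "symp (lie_eq :: ('n, 'k) free_nonassoc \<Rightarrow> _)"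
    by (metis lie_eq_def lie_ideal_uminus minus_diff_eq sympI)
  show "transp (lie_eq :: ('n, 'k) free_nonassoc \<Rightarrow> _)"
  proof (rule transpI)
    fix p q r :: "('n, 'k) free_nonassoc"
    assume "lie_eq p q" "lie_eq q r"
    then show "lie_eq p r"
      using lie_ideal.add[of "p - q" "q - r"] by (simp add: lie_eq_def)
  qed
qed

instantiation free_lie :: (type, comm_ring_1) ab_group_add
begin
lift_definition zero_free_lie :: "('a, 'b::comm_ring_1) free_lie" is 0 .
lift_definition plus_free_lie :: "('a, 'b::comm_ring_1) free_lie \<Rightarrow> ('a, 'b) free_lie \<Rightarrow> ('a, 'b) free_lie"
  is "(+)"
  using lie_ideal.add by (fastforce simp: lie_eq_def algebra_simps)
lift_definition uminus_free_lie :: "('a, 'b::comm_ring_1) free_lie \<Rightarrow> ('a, 'b) free_lie" is uminus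
  using lie_ideal_uminus by (fastforce simp: lie_eq_def algebra_simps)
lift_definition minus_free_lie :: "('a, 'b::comm_ring_1) free_lie \<Rightarrow> ('a, 'b) free_lie \<Rightarrow> ('a, 'b) free_lie"
  is "(-)"
  using lie_ideal_diff by (fastforce simp: lie_eq_def algebra_simps)
instance
  by standard (transfer; simp add: lie_eq_def lie_ideal.zero algebra_simps)+
end

lift_definition lie_scale :: "'k::comm_ring_1 \<Rightarrow> ('n, 'k) free_lie \<Rightarrow> ('n, 'k) free_lie" is smult
  using lie_ideal.smult by (fastforce simp: lie_eq_def smult.scale_right_diff_distrib[symmetric])

lift_definition lie_bracket :: "('n, 'k::comm_ring_1) free_lie \<Rightarrow> ('n, 'k) free_lie \<Rightarrow> ('n, 'k) free_lie"
  is nmult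
proof -
  fix p p' q q' :: "('n, 'k) free_nonassoc"
  assume "lie_eq p p'" "lie_eq q q'"
  then have "nmult (p - p') q + nmult p' (q - q') \<in> lie_ideal"
    by (simp add: lie_eq_def lie_ideal.intros)
  then show "lie_eq (nmult p q) (nmult p' q')"
    by (simp add: lie_eq_def nmult_linear)
qed

lift_definition lie_var :: "'n \<Rightarrow> ('n, 'k::comm_ring_1) free_lie"
  is "\<lambda>i. Poly_Mapping.single (Gen i) 1" .

lemma lie_scale_module: "module (lie_scale :: 'k::comm_ring_1 \<Rightarrow> ('n, 'k) free_lie \<Rightarrow> _)"
  by unfold_locales (transfer; simp add: lie_eq_def lie_ideal.zero smult.scale_right_distrib smult.scale_left_distrib)+

interpretation lie_scale: module "lie_scale :: 'k::comm_ring_1 \<Rightarrow> ('n, 'k) free_lie \<Rightarrow> _"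
  by (rule lie_scale_module)

lemma lie_bracket_linear:
  "lie_bracket (x + x') y = lie_bracket x y + lie_bracket x' y"
  "lie_bracket x (y + y') = lie_bracket x y + lie_bracket x y'"
  "lie_bracket (lie_scale c x) y = lie_scale c (lie_bracket x y)"
  "lie_bracket x (lie_scale c y) = lie_scale c (lie_bracket x y)"
  by (transfer, simp add: lie_eq_def lie_ideal.zero nmult_linear)+

lemma lie_bracket_self: "lie_bracket x x = 0"
  by transfer (simp add: lie_eq_def lie_ideal.square)

lemma lie_bracket_jacobi:
  "lie_bracket x (lie_bracket y z) + lie_bracket y (lie_bracket z x) + lie_bracket z (lie_bracket x y) = 0"
  by transfer (simp add: lie_eq_def lie_ideal.jacobi)

text \<open>Only nonempty lists matter; the value on the empty list is arbitrary.\<close>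

fun lie_commL :: "('n, 'k::comm_ring_1) free_lie list \<Rightarrow> ('n, 'k) free_lie" where
  "lie_commL [] = 0"
| "lie_commL [y] = y"
| "lie_commL (y # ys) = lie_bracket y (lie_commL ys)"

section \<open>The commutator evaluation\<close>

fun magma_eval :: "'n magma \<Rightarrow> ('n, 'k::comm_ring_1) free_assoc" where
  "magma_eval (Gen i) = assoc_var i"
| "magma_eval (Prod r s) = magma_eval r * magma_eval s - magma_eval s * magma_eval r"

definition nonassoc_eval :: "('n, 'k::comm_ring_1) free_nonassoc \<Rightarrow> ('n, 'k) free_assoc"
  where "nonassoc_eval p = (\<Sum>t\<in>Poly_Mapping.keys p. smult (Poly_Mapping.lookup p t) (magma_eval t))"

lemma nonassoc_eval_superset:
  "finite A \<Longrightarrow> Poly_Mapping.keys p \<subseteq> A \<Longrightarrow> nonassoc_eval p = (\<Sum>t\<in>A. smult (Poly_Mapping.lookup p t) (magma_eval t))"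
  unfolding nonassoc_eval_def by (rule sum.mono_neutral_left) (auto simp: in_keys_iff)

lemma nonassoc_eval_0 [simp]: "nonassoc_eval 0 = 0"
  by (simp add: nonassoc_eval_def)

lemma nonassoc_eval_add: "nonassoc_eval (p + q) = nonassoc_eval p + nonassoc_eval q"
proof -
  let ?A = "Poly_Mapping.keys p \<union> Poly_Mapping.keys q"
  have "Poly_Mapping.keys (p + q) \<subseteq> ?A" by (rule Poly_Mapping.keys_add)
  then show ?thesis
    by (simp add: nonassoc_eval_superset[of ?A] lookup_add smult.scale_left_distrib sum.distrib)
qed

lemma nonassoc_eval_smult: "nonassoc_eval (smult c p) = smult c (nonassoc_eval p)"
proof -
  have "Poly_Mapping.keys (smult c p) \<subseteq> Poly_Mapping.keys p" by (auto simp: in_keys_iff)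
  then show ?thesis
    by (simp add: nonassoc_eval_superset[of "Poly_Mapping.keys p"] smult.scale_sum_right)
qed

lemma nonassoc_eval_single [simp]: "nonassoc_eval (Poly_Mapping.single t 1) = magma_eval t"
  by (simp add: nonassoc_eval_def)

lemma nonassoc_eval_nmult:
  "nonassoc_eval (nmult p q) = nonassoc_eval p * nonassoc_eval q - nonassoc_eval q * nonassoc_eval p"
proof (induction p rule: pm_linear_induct)
  case (single t c)
  show ?case
  proof (induction q rule: pm_linear_induct)
    case (single s d)
    show ?case
      by (simp add: nmult_linear nmult_single nonassoc_eval_smult smult_mult_left smult_mult_right
            smult.scale_right_diff_distrib mult.commute)
  qed (simp_all add: nmult_linear nonassoc_eval_add algebra_simps)
qed (simp_all add: nmult_linear nonassoc_eval_add algebra_simps)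

lemma nonassoc_eval_lie_ideal: "p \<in> lie_ideal \<Longrightarrow> nonassoc_eval p = 0"
  by (induction rule: lie_ideal.induct)
     (simp_all add: nonassoc_eval_add nonassoc_eval_smult nonassoc_eval_nmult algebra_simps)

lift_definition comm_eval :: "('n, 'k::comm_ring_1) free_lie \<Rightarrow> ('n, 'k) free_assoc" is nonassoc_eval
proof -
  fix p q :: "('n, 'k) free_nonassoc"
  assume "lie_eq p q"
  then show "nonassoc_eval p = nonassoc_eval q"
    using nonassoc_eval_lie_ideal[of "p - q"] nonassoc_eval_add[of "p - q" q] by (simp add: lie_eq_def)
qed

lemma comm_eval_hom:
  "comm_eval (lie_var i) = assoc_var i"
  "comm_eval (x + y) = comm_eval x + comm_eval y"
  "comm_eval (lie_scale c x) = smult c (comm_eval x)"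
  "comm_eval (lie_bracket x y) = comm_eval x * comm_eval y - comm_eval y * comm_eval x"
  by (transfer, simp add: nonassoc_eval_add nonassoc_eval_smult nonassoc_eval_nmult)+

section \<open>The multigrading and the weight map\<close>

fun mdeg :: "'n magma \<Rightarrow> 'n \<Rightarrow> nat" where
  "mdeg (Gen j) i = (if i = j then 1 else 0)"
| "mdeg (Prod r s) i = mdeg r i + mdeg s i"

definition mweight :: "('n::finite \<Rightarrow> 'k::comm_ring_1) \<Rightarrow> ('n \<Rightarrow> nat) \<Rightarrow> 'k"
  where "mweight w m = (\<Sum>i\<in>UNIV. of_nat (m i) * w i)"

lift_definition lie_component :: "('n \<Rightarrow> nat) \<Rightarrow> ('n, 'k::comm_ring_1) free_lie \<Rightarrow> bool"
  is "\<lambda>m p. \<exists>q. lie_eq p q \<and> (\<forall>t\<in>Poly_Mapping.keys q. mdeg t = m)"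
  by (metis free_lie.abs_eq_iff)

definition nonassoc_weight ::
  "('n::finite \<Rightarrow> 'k::comm_ring_1) \<Rightarrow> ('n, 'k) free_nonassoc \<Rightarrow> ('n, 'k) free_nonassoc"
  where "nonassoc_weight w p = Poly_Mapping.mapp (\<lambda>t c. mweight w (mdeg t) * c) p"

lemma lookup_nonassoc_weight [simp]: "Poly_Mapping.lookup (nonassoc_weight w p) t = mweight w (mdeg t) * Poly_Mapping.lookup p t"
  by (simp add: nonassoc_weight_def lookup_mapp when_def in_keys_iff)

lemma nonassoc_weight_linear:
  "nonassoc_weight w (p + q) = nonassoc_weight w p + nonassoc_weight w q"
  "nonassoc_weight w (p - q) = nonassoc_weight w p - nonassoc_weight w q"
  "nonassoc_weight w (smult c p) = smult c (nonassoc_weight w p)"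
  "nonassoc_weight w 0 = 0"
  by (auto intro!: poly_mapping_eqI simp: lookup_add lookup_minus algebra_simps)

lemma nonassoc_weight_nmult:
  "nonassoc_weight w (nmult p q) = nmult (nonassoc_weight w p) q + nmult p (nonassoc_weight w q)"
  by (rule poly_mapping_eqI)
     (auto simp: lookup_nmult lookup_add mweight_def sum.distrib algebra_simps split: magma.splits)

lemma nonassoc_weight_lie_ideal: "p \<in> lie_ideal \<Longrightarrow> nonassoc_weight w p \<in> lie_ideal"
proof (induction rule: lie_ideal.induct)
  case (square p)
  let ?d = "nonassoc_weight w p"
  have "nmult (p + ?d) (p + ?d) - nmult p p - nmult ?d ?d \<in> lie_ideal"
    by (intro lie_ideal_diff lie_ideal.square)
  then show ?case
    by (simp add: nonassoc_weight_nmult nmult_linear algebra_simps)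
next
  case (jacobi p q r)
  let ?D = "nonassoc_weight w"
  let ?J = "\<lambda>p q r. nmult p (nmult q r) + nmult q (nmult r p) + nmult r (nmult p q)"
  have "?J (?D p) q r + ?J p (?D q) r + ?J p q (?D r) \<in> lie_ideal"
    by (intro lie_ideal.add[OF lie_ideal.add] lie_ideal.jacobi)
  then show ?case
    by (simp add: nonassoc_weight_nmult nonassoc_weight_linear nmult_linear algebra_simps)
qed (auto simp: nonassoc_weight_linear nonassoc_weight_nmult intro: lie_ideal.intros)

text \<open>
  The weight map multiplies the component of multidegree \<open>m\<close> by \<open>\<Sum>i. m\<^sub>i w\<^sub>i\<close>
  (characterised by \<open>lie_weight_component\<close> and \<open>lie_weight_unique\<close> below).
  An integer weight \<open>z\<close> acts on a \<open>K\<close>-module as \<open>of_int z\<close>, so it is enough to have weights in \<open>K\<close>.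
\<close>

lift_definition lie_weight ::
  "('n::finite \<Rightarrow> 'k::comm_ring_1) \<Rightarrow> ('n, 'k) free_lie \<Rightarrow> ('n, 'k) free_lie" is nonassoc_weight
  by (metis lie_eq_def nonassoc_weight_lie_ideal nonassoc_weight_linear(2))

lemma lie_weight_linear:
  "lie_weight w (x + y) = lie_weight w x + lie_weight w y"
  "lie_weight w (lie_scale c x) = lie_scale c (lie_weight w x)"
  by (transfer, simp add: nonassoc_weight_linear lie_eq_def lie_ideal.zero)+

lemma lie_weight_component:
  fixes x :: "('n::finite, 'k::comm_ring_1) free_lie"
  assumes "lie_component m x"
  shows "lie_weight w x = lie_scale (mweight w m) x"
  using assms
proof transfer
  fix m :: "'n \<Rightarrow> nat" and p :: "('n, 'k) free_nonassoc" and w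
  assume "\<exists>q. lie_eq p q \<and> (\<forall>t\<in>Poly_Mapping.keys q. mdeg t = m)"
  then obtain q where q: "lie_eq p q" "\<forall>t\<in>Poly_Mapping.keys q. mdeg t = m" by blast
  have "Poly_Mapping.lookup q t = 0 \<or> mdeg t = m" for t
    using q(2) by (auto simp: in_keys_iff)
  then have "nonassoc_weight w q = smult (mweight w m) q"
    by (intro poly_mapping_eqI) (metis lookup_nonassoc_weight lookup_smult mult_zero_right)
  then have "nonassoc_weight w p - smult (mweight w m) p
      = nonassoc_weight w (p - q) - smult (mweight w m) (p - q)"
    by (simp add: nonassoc_weight_linear smult.scale_right_diff_distrib)
  moreover have "nonassoc_weight w (p - q) - smult (mweight w m) (p - q) \<in> lie_ideal"
    using q(1) by (meson lie_eq_def lie_ideal_diff nonassoc_weight_lie_ideal lie_ideal.smult)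
  ultimately show "lie_eq (nonassoc_weight w p) (smult (mweight w m) p)"
    by (simp add: lie_eq_def)
qed

lemma lie_component_induct:
  assumes "P 0" and "\<And>x y. P x \<Longrightarrow> P y \<Longrightarrow> P (x + y)" and "\<And>m x. lie_component m x \<Longrightarrow> P x"
  shows "P x"
proof (induction x rule: free_lie.abs_induct)
  case (1 p)
  show ?case
  proof (induction p rule: pm_linear_induct)
    case zero
    then show ?case using assms(1) by (simp add: zero_free_lie.abs_eq)
  next
    case (add p q)
    then show ?case using assms(2) by (metis plus_free_lie.abs_eq)
  next
    case (single t c)
    have "lie_component (mdeg t) (abs_free_lie (smult c (Poly_Mapping.single t 1)))"
      unfolding lie_component.abs_eq
      by (rule exI[of _ "smult c (Poly_Mapping.single t 1)"])
         (auto simp: lie_eq_def lie_ideal.zero in_keys_iff lookup_single when_def split: if_splits)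
    then show ?case by (rule assms(3))
  qed
qed

lemma lie_weight_unique:
  assumes "\<And>x y. f (x + y) = f x + f y" and "\<And>m x. lie_component m x \<Longrightarrow> f x = lie_scale (mweight w m) x"
  shows "f = lie_weight w"
proof
  fix x
  have "f 0 = 0"
    using assms(1)[of 0 0] by simp
  moreover have "lie_weight w 0 = 0"
    using lie_weight_linear(1)[of w 0 0] by simp
  ultimately show "f x = lie_weight w x"
    by (induction x rule: lie_component_induct)
       (auto simp: assms lie_weight_linear lie_weight_component)
qed

lemma lie_weight_var:
  fixes w :: "'n::finite \<Rightarrow> 'k::comm_ring_1"
  shows "lie_weight w (lie_var i) = lie_scale (w i) (lie_var i)"
proof -
  have "lie_component (\<lambda>j. if j = i then 1 else 0) (lie_var i :: ('n, 'k) free_lie)"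
    by transfer (rule exI[of _ "Poly_Mapping.single (Gen _) 1"], auto simp: lie_eq_def lie_ideal.zero)
  moreover have "mweight w (\<lambda>j. if j = i then 1 else 0) = w i"
    by (simp add: mweight_def if_distrib[of of_nat] if_distrib[of "\<lambda>x. x * _"] cong: if_cong)
  ultimately show ?thesis by (metis lie_weight_component)
qed

end

theory Submission
  imports Defs "HOL-Library.Product_Plus"
begin

text \<open>
  Since \<open>w\<close> is a derivation of the free Lie algebra \<open>L\<close>, we get a Lie action of \<open>L\<close> on \<open>L \<times> K\<close> by
  \<open>x \<cdot> (y, c) = ([x, y] + c w(x), 0)\<close>. It extends to the free associative algebra, where
  \<open>comm_eval P\<close> acts as \<open>P\<close> does. In particular it sends \<open>(0, 1)\<close> to \<open>(w(P), 0)\<close>, while a nonempty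
  word sends \<open>(0, 1)\<close> to the left-iterated commutator of its letters with \<open>w\<close> applied to the last one.
\<close>

text \<open>Since \<open>foldr\<close> lets the last letter act first, this is a left action. The
  scalar multiplication \<open>s\<close> is a parameter so that any module can be acted on.\<close>

definition assoc_act ::
  "('k::comm_ring_1 \<Rightarrow> 'm \<Rightarrow> 'm) \<Rightarrow> ('n \<Rightarrow> 'm \<Rightarrow> 'm) \<Rightarrow> ('n, 'k) free_assoc \<Rightarrow> 'm \<Rightarrow> 'm::ab_group_add"
  where "assoc_act s g p m =
    (\<Sum>u\<in>Poly_Mapping.keys p. s (Poly_Mapping.lookup p u) (foldr g (letters u) m))"

context module
begin

text \<open>Cancellation can shrink the support of a sum; a common finite index set allows termwise
  comparison all the same.\<close>

lemma assoc_act_superset: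
  assumes "finite A" "Poly_Mapping.keys p \<subseteq> A"
  shows "assoc_act scale g p m = (\<Sum>u\<in>A. Poly_Mapping.lookup p u *s foldr g (letters u) m)"
  unfolding assoc_act_def using assms by (intro sum.mono_neutral_left) (auto simp: in_keys_iff)

lemma assoc_act_0 [simp]: "assoc_act scale g 0 m = 0"
  by (simp add: assoc_act_def)

lemma assoc_act_add: "assoc_act scale g (p + q) m = assoc_act scale g p m + assoc_act scale g q m"
proof -
  let ?A = "Poly_Mapping.keys p \<union> Poly_Mapping.keys q"
  have "Poly_Mapping.keys (p + q) \<subseteq> ?A" by (rule Poly_Mapping.keys_add)
  then show ?thesis
    by (simp add: assoc_act_superset[of ?A] lookup_add scale_left_distrib sum.distrib)
qed

lemma assoc_act_smult: "assoc_act scale g (smult c p) m = c *s assoc_act scale g p m"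
proof -
  have "Poly_Mapping.keys (smult c p) \<subseteq> Poly_Mapping.keys p" by (auto simp: in_keys_iff)
  then show ?thesis
    by (simp add: assoc_act_superset[of "Poly_Mapping.keys p"] scale_sum_right)
qed

lemma assoc_act_diff: "assoc_act scale g (p - q) m = assoc_act scale g p m - assoc_act scale g q m"
  using assoc_act_add[of g "p - q" q m] by (simp add: algebra_simps)

lemma assoc_act_sum: "assoc_act scale g (\<Sum>x\<in>A. f x) m = (\<Sum>x\<in>A. assoc_act scale g (f x) m)"
  by (induction A rule: infinite_finite_induct) (simp_all add: assoc_act_add)

lemma assoc_act_single [simp]:
  "assoc_act scale g (Poly_Mapping.single u 1) m = foldr g (letters u) m"
  by (simp add: assoc_act_def)

text \<open>On words, concatenation becomes composition of operators. Linearity of every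
  \<open>g i\<close> carries this over to linear combinations in the second factor.\<close>

lemma assoc_act_mult:
  assumes g: "\<And>i. module_hom scale scale (g i)"
  shows "assoc_act scale g (p * q) m = assoc_act scale g p (assoc_act scale g q m)"
proof -
  have word_add: "foldr g is (x + y) = foldr g is x + foldr g is y" for "is" x y
    by (induction "is") (simp_all add: module_hom.add[OF g])
  have word_scale: "foldr g is (c *s x) = c *s foldr g is x" for "is" c x
    by (induction "is") (simp_all add: module_hom.scale[OF g])
  have word_0: "foldr g is 0 = 0" for "is"
    by (induction "is") (simp_all add: module_hom.zero[OF g])
  show ?thesis
  proof (induction p rule: pm_linear_induct)
    case (single u c)
    show ?case
    proof (induction q rule: pm_linear_induct)
      case (single v d)
      show ?case
        by (simp add: smult_mult_left smult_mult_right mult_single assoc_act_smult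
            plus_word_def word_scale mult.commute)
    qed (simp_all add: distrib_left assoc_act_add assoc_act_smult word_add word_0 scale_right_distrib)
  qed (simp_all add: distrib_right assoc_act_add)
qed

end

lemma prod_list_assoc_var: "prod_list (map assoc_var is) = Poly_Mapping.single (Word is) 1"
proof (induction "is")
  case Nil
  then show ?case by (simp flip: zero_word_def)
next
  case (Cons i "is")
  then show ?case by (simp add: assoc_var_def mult_single plus_word_def)
qed

text \<open>Every element is the class of a linear combination of bracketings, and each bracketing
  is built from generators.\<close>

lemma free_lie_induct [case_names zero add scale var bracket]:
  assumes "P 0" and "\<And>x y. P x \<Longrightarrow> P y \<Longrightarrow> P (x + y)" and "\<And>c x. P x \<Longrightarrow> P (lie_scale c x)"
    and "\<And>i. P (lie_var i)" and "\<And>x y. P x \<Longrightarrow> P y \<Longrightarrow> P (lie_bracket x y)"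
  shows "P x"
proof (induction x rule: free_lie.abs_induct)
  case (1 p)
  have tree: "P (abs_free_lie (Poly_Mapping.single t 1))" for t
  proof (induction t)
    case (Gen i)
    then show ?case using assms(4) by (simp add: lie_var.abs_eq)
  next
    case (Prod r s)
    then show ?case
      using assms(5) by (metis lie_bracket.abs_eq nmult_single)
  qed
  show ?case
  proof (induction p rule: pm_linear_induct)
    case zero
    then show ?case using assms(1) by (simp add: zero_free_lie.abs_eq)
  next
    case (add p q)
    then show ?case using assms(2) by (metis plus_free_lie.abs_eq)
  next
    case (single t c)
    then show ?case using assms(3)[OF tree] by (metis lie_scale.abs_eq)
  qed
qed

lemma lie_bracket_anticomm: "lie_bracket x y = - lie_bracket y x"
proof -
  have "lie_bracket x y + lie_bracket y x = 0"
    using lie_bracket_self[of "x + y"]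
    unfolding lie_bracket_linear lie_bracket_self[of x] lie_bracket_self[of y] by (simp add: add.commute)
  then show ?thesis by (simp add: eq_neg_iff_add_eq_0)
qed

lemma lie_bracket_0 [simp]: "lie_bracket x 0 = 0" "lie_bracket 0 x = 0"
  using lie_bracket_linear(2)[of x 0 0] lie_bracket_linear(1)[of 0 0 x] by simp_all

lemma lie_bracket_minus_right: "lie_bracket x (- y) = - lie_bracket x y"
  using lie_bracket_linear(2)[of x y "- y"] by (simp add: eq_neg_iff_add_eq_0 add.commute)

text \<open>Jacobi in the form that the adjoint action is a representation.\<close>

lemma lie_bracket_commutator:
  "lie_bracket (lie_bracket x y) z = lie_bracket x (lie_bracket y z) - lie_bracket y (lie_bracket x z)"
proof -
  have "lie_bracket y (lie_bracket z x) = - lie_bracket y (lie_bracket x z)"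
    by (subst lie_bracket_anticomm[of z]) (rule lie_bracket_minus_right)
  moreover have "lie_bracket z (lie_bracket x y) = - lie_bracket (lie_bracket x y) z"
    by (rule lie_bracket_anticomm)
  ultimately show ?thesis
    using lie_bracket_jacobi[of x y z] by (simp add: algebra_simps)
qed

text \<open>Multidegrees add under the bracket, so weights do too, and \<open>w\<close> is a
  derivation.\<close>

lemma lie_weight_bracket:
  "lie_weight w (lie_bracket x y) = lie_bracket (lie_weight w x) y + lie_bracket x (lie_weight w y)"
  by transfer (simp add: nonassoc_weight_nmult lie_eq_def lie_ideal.zero)

lemma lie_weight_0 [simp]: "lie_weight w 0 = 0"
  using lie_weight_linear(1)[of w 0 0] by simp

lemma comm_eval_0 [simp]: "comm_eval 0 = 0"
  using comm_eval_hom(2)[of 0 0] by simp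

definition pair_scale ::
  "'k::comm_ring_1 \<Rightarrow> ('n, 'k) free_lie \<times> 'k \<Rightarrow> ('n, 'k) free_lie \<times> 'k"
  where "pair_scale c m = (lie_scale c (fst m), c * snd m)"

interpretation pair: module pair_scale
  by unfold_locales
     (simp_all add: pair_scale_def prod_eq_iff lie_scale.scale_right_distrib
        lie_scale.scale_left_distrib algebra_simps)

definition weight_act ::
  "('n::finite \<Rightarrow> 'k::comm_ring_1) \<Rightarrow> ('n, 'k) free_lie \<Rightarrow> ('n, 'k) free_lie \<times> 'k \<Rightarrow> ('n, 'k) free_lie \<times> 'k"
  where "weight_act w x m = (lie_bracket x (fst m) + lie_scale (snd m) (lie_weight w x), 0)"

lemma module_hom_weight_act: "module_hom pair_scale pair_scale (weight_act w x)"
  by unfold_locales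
     (simp_all add: weight_act_def pair_scale_def prod_eq_iff lie_bracket_linear
        lie_scale.scale_right_distrib lie_scale.scale_left_distrib)

text \<open>Both sides are linear in \<open>x\<close>, agree on variables and turn brackets into
  commutators of operators. The vector \<open>m\<close> stays arbitrary because the bracket case
  uses the hypotheses at vectors already acted upon.\<close>

lemma assoc_act_comm_eval:
  "assoc_act pair_scale (\<lambda>i. weight_act w (lie_var i)) (comm_eval x) m = weight_act w x m"
proof (induction x arbitrary: m rule: free_lie_induct)
  case zero
  then show ?case by (simp add: weight_act_def zero_prod_def)
next
  case (add x y)
  then show ?case
    by (simp add: comm_eval_hom pair.assoc_act_add weight_act_def lie_bracket_linear
        lie_weight_linear lie_scale.scale_right_distrib)
next
  case (scale c x)
  then show ?case
    unfolding comm_eval_hom pair.assoc_act_smult scale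
    by (simp add: weight_act_def pair_scale_def
        lie_bracket_linear lie_weight_linear lie_scale.scale_right_distrib mult.commute)
next
  case (var i)
  then show ?case by (simp add: comm_eval_hom assoc_var_def)
next
  case (bracket x y)
  \<comment> \<open>This sign matches the derivation rule with the commutator of the two actions on
    the \<open>K\<close> coordinate.\<close>
  have "lie_bracket (lie_weight w x) y = - lie_bracket y (lie_weight w x)"
    by (rule lie_bracket_anticomm)
  then have "weight_act w (lie_bracket x y) m =
      weight_act w x (weight_act w y m) - weight_act w y (weight_act w x m)"
    by (simp add: weight_act_def lie_bracket_commutator lie_weight_bracket lie_bracket_linear
        lie_scale.scale_right_diff_distrib)
  then show ?case
    by (simp add: comm_eval_hom pair.assoc_act_diff pair.assoc_act_mult[OF module_hom_weight_act]
        bracket)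
qed

text \<open>The last letter acts first and sends (0, 1) to its weighted variable with
  \<open>K\<close> coordinate 0. From then on every letter acts as a plain bracket.\<close>

lemma foldr_weight_act:
  assumes "is \<noteq> []"
  shows "foldr (\<lambda>i. weight_act w (lie_var i)) is (0, 1) =
    (lie_commL (map lie_var (butlast is) @ [lie_weight w (lie_var (last is))]), 0)"
  using assms
proof (induction "is" rule: list_nonempty_induct)
  case (single i)
  then show ?case by (simp add: weight_act_def)
next
  case (cons i "is")
  \<comment> \<open>The split exhibits the tail as a nonempty list, as the bracket equation of
    \<open>lie_commL\<close> demands.\<close>
  then show ?case by (cases "butlast is") (simp_all add: weight_act_def)
qed

theorem theorem1p1:
  fixes w :: "'n::finite \<Rightarrow> 'k::comm_ring_1"
    and P :: "('n, 'k) free_lie"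
    and S :: "'s set" and a :: "'s \<Rightarrow> 'k" and i :: "'s \<Rightarrow> 'n list"
  assumes "finite S"
    and "\<And>s. s \<in> S \<Longrightarrow> i s \<noteq> []"
    and "comm_eval P = (\<Sum>s\<in>S. smult (a s) (prod_list (map assoc_var (i s))))"
  shows "lie_weight w P =
    (\<Sum>s\<in>S. lie_scale (a s)
      (lie_commL (map lie_var (butlast (i s)) @ [lie_weight w (lie_var (last (i s)))])))"
proof -
  have "(lie_weight w P, 0) = weight_act w P (0, 1)"
    by (simp add: weight_act_def)
  \<comment> \<open>Now \<open>P\<close> enters only through its associative expansion, which may be
    replaced by the given sum of words.\<close>
  also have "\<dots> = assoc_act pair_scale (\<lambda>i. weight_act w (lie_var i)) (comm_eval P) (0, 1)"
    by (simp add: assoc_act_comm_eval)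
  also have "\<dots> = (\<Sum>s\<in>S. pair_scale (a s) (foldr (\<lambda>i. weight_act w (lie_var i)) (i s) (0, 1)))"
    by (simp add: assms(3) pair.assoc_act_sum pair.assoc_act_smult prod_list_assoc_var)
  also have "\<dots> = (\<Sum>s\<in>S. (lie_scale (a s)
      (lie_commL (map lie_var (butlast (i s)) @ [lie_weight w (lie_var (last (i s)))])), 0))"
    by (intro sum.cong refl) (simp add: assms(2) foldr_weight_act pair_scale_def)
  finally show ?thesis
    by (simp add: prod_eq_iff fst_sum)
qed

end
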